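(* If $R$ is an integral domain, then its unique aic (up to isomorphism of $R$-algebras) is $R^+$, that is, the integral closure of $R$ in the algebraic closure $\overline{\mathrm{Q}(R)}$ of the field of fractions $\mathrm{Q}(R)$ of $R$.
   Context: All rings are commutative and unital. A ring extension $R\subseteq S$ is tight if every non-zero ideal of $S$ has non-zero intersection with $R$. A ring $S$ is absolutely integrally closed (ai closed) if every monic polynomial in $S[X]$ factorizes as a product of monic linear polynomials in $S[X]$ (uniqueness of the factorization is not required). An absolute integral closure (aic) of $R$ is an extension ring $S\supseteq R$ that is ai closed, integral over $R$ and tight over $R$. *)

theory Defs
  imports
    "HOL-Algebra.Algebraic_Closure_Type"
    "Jordan_Normal_Form.Char_Poly"
begin

section \<open>Ring extensions\<close>

text \<open>
  Rings are types of class \<open>comm_ring_1\<close>. A ring extension \<open>R \<subseteq> S\<close> is given by an injective ring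
  homomorphism \<open>f :: R \<Rightarrow> S\<close> (\<open>inj_comm_ring_hom\<close>), whose image plays the role of the subring \<open>R\<close>
  of \<open>S\<close>. The map \<open>f\<close> is also the \<open>R\<close>-algebra structure of \<open>S\<close>.

  ``ai closed'' stands for absolutely integrally closed and ``aic'' for absolute integral closure.
\<close>

definition integral_over :: "('a::comm_ring_1 \<Rightarrow> 'b::comm_ring_1) \<Rightarrow> 'b \<Rightarrow> bool" where
  "integral_over f x \<longleftrightarrow> (\<exists>p. monic p \<and> poly (map_poly f p) x = 0)"

definition integral_extension :: "('a::comm_ring_1 \<Rightarrow> 'b::comm_ring_1) \<Rightarrow> bool" where
  "integral_extension f \<longleftrightarrow> (\<forall>x. integral_over f x)"

definition tight_extension :: "('a::comm_ring_1 \<Rightarrow> 'b::comm_ring_1) \<Rightarrow> bool" where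
  "tight_extension f \<longleftrightarrow>
     (\<forall>I. ideal I (ring_of_type_algebra :: 'b ring) \<longrightarrow> I \<noteq> {0} \<longrightarrow> I \<inter> range f \<noteq> {0})"

definition ai_closed :: "'b::comm_ring_1 itself \<Rightarrow> bool" where
  "ai_closed _ \<longleftrightarrow>
     (\<forall>p :: 'b poly. monic p \<longrightarrow> (\<exists>as. p = (\<Prod>a\<leftarrow>as. [:- a, 1:])))"

definition is_aic :: "('a::comm_ring_1 \<Rightarrow> 'b::comm_ring_1) \<Rightarrow> bool" where
  "is_aic f \<longleftrightarrow> inj_comm_ring_hom f \<and> ai_closed TYPE('b) \<and> integral_extension f \<and> tight_extension f"

definition algebra_isom ::
  "('r::comm_ring_1 \<Rightarrow> 'a::comm_ring_1) \<Rightarrow> ('r \<Rightarrow> 'b::comm_ring_1) \<Rightarrow> ('a \<Rightarrow> 'b) \<Rightarrow> bool" where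
  "algebra_isom f g \<phi> \<longleftrightarrow> comm_ring_isom \<phi> \<and> (\<forall>r. \<phi> (f r) = g r)"


section \<open>Integral elements of a field extension form a subring\<close>

lemma integral_over_hom:
  assumes "comm_ring_hom f"
  shows "integral_over f (f r)"
proof -
  interpret comm_ring_hom f by fact
  have "poly (map_poly f [:- r, 1:]) (f r) = 0"
    by (simp add: map_poly_pCons hom_distribs)
  then show ?thesis
    unfolding integral_over_def by (intro exI[of _ "[:- r, 1:]"]) simp
qed

lemma module_hom_scale:
  assumes "comm_ring_hom f"
  shows "Modules.module (\<lambda>r x. f r * x)"
proof -
  interpret comm_ring_hom f by fact
  show ?thesis
    by unfold_locales (simp_all add: hom_distribs algebra_simps)
qed

text \<open>
  If multiplication by \<open>z\<close> maps a finitely generated non-zero \<open>R\<close>-submodule into itself, then \<open>z\<close> is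
  a root of the characteristic polynomial of the corresponding matrix over \<open>R\<close>.
\<close>

lemma integral_over_if_stable:
  fixes f :: "'a::comm_ring_1 \<Rightarrow> 'b::field"
  assumes f: "comm_ring_hom f"
    and V: "finite V" "v0 \<in> V" "v0 \<noteq> 0"
    and stable: "\<And>v. v \<in> V \<Longrightarrow> z * v \<in> module.span (\<lambda>r x. f r * x) V"
  shows "integral_over f z"
proof -
  interpret comm_ring_hom f by fact
  interpret M: Modules.module "\<lambda>r x. f r * x" by (rule module_hom_scale[OF f])
  have "\<forall>v\<in>V. \<exists>c. z * v = (\<Sum>w\<in>V. f (c w) * w)"
    using stable M.span_finite[OF V(1)] by auto
  then obtain C where C: "\<And>v. v \<in> V \<Longrightarrow> z * v = (\<Sum>w\<in>V. f (C v w) * w)"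
    by metis
  obtain vs where vs: "set vs = V" "distinct vs"
    using finite_distinct_list[OF V(1)] by blast
  define n where "n = length vs"
  define A where "A = mat n n (\<lambda>(i,j). C (vs ! i) (vs ! j))"
  define u where "u = vec n (\<lambda>i. vs ! i)"
  have A: "A \<in> carrier_mat n n" and u: "u \<in> carrier_vec n"
    by (auto simp: A_def u_def)
  have bij: "bij_betw ((!) vs) {0..<n} V"
    using bij_betw_nth[OF vs(2), of "{0..<n}" V] vs(1) by (simp add: n_def atLeast0LessThan)
  have row: "(\<Sum>j = 0..<n. f (C (vs ! i) (vs ! j)) * vs ! j) = z * vs ! i" if "i < n" for i
  proof -
    have "(\<Sum>j = 0..<n. f (C (vs ! i) (vs ! j)) * vs ! j) = (\<Sum>w\<in>V. f (C (vs ! i) w) * w)"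
      by (rule sum.reindex_bij_betw[OF bij])
    also have "\<dots> = z * vs ! i"
      using C[of "vs ! i"] that vs(1) by (metis n_def nth_mem)
    finally show ?thesis .
  qed
  have "map_mat f A *\<^sub>v u = z \<cdot>\<^sub>v u"
    by (rule eq_vecI) (auto simp: A_def u_def scalar_prod_def row)
  moreover have "u \<noteq> 0\<^sub>v n"
  proof
    assume 0: "u = 0\<^sub>v n"
    obtain i where "i < n" "vs ! i = v0"
      using V(2) vs(1) by (metis in_set_conv_nth n_def)
    then have "u $ i = v0" by (simp add: u_def)
    with 0 \<open>i < n\<close> V(3) show False by simp
  qed
  ultimately have "eigenvector (map_mat f A) u z"
    using A u by (simp add: eigenvector_def)
  then have "eigenvalue (map_mat f A) z"
    unfolding eigenvalue_def by blast
  then have "poly (char_poly (map_mat f A)) z = 0"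
    using eigenvalue_root_char_poly[of "map_mat f A" n z] A by simp
  then have "poly (map_poly f (char_poly A)) z = 0"
    using char_poly_hom[OF A] by simp
  moreover have "monic (char_poly A)"
    using degree_monic_char_poly[OF A] by simp
  ultimately show ?thesis unfolding integral_over_def by blast
qed

lemma integral_over_power_span:
  fixes f :: "'a::comm_ring_1 \<Rightarrow> 'b::field"
  assumes f: "comm_ring_hom f" and x: "integral_over f x"
  obtains n where "n > 0"
    "x ^ n \<in> module.span (\<lambda>r x. f r * x) ((\<lambda>i. x ^ i) ` {..<n})"
proof -
  interpret comm_ring_hom f by fact
  interpret M: Modules.module "\<lambda>r x. f r * x" by (rule module_hom_scale[OF f])
  obtain p where p: "monic p" "poly (map_poly f p) x = 0"
    using x unfolding integral_over_def by blast
  define n where "n = Polynomial.degree p"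
  have deg: "Polynomial.degree (map_poly f p) = n"
    unfolding n_def by (rule degree_map_poly) (use p(1) in auto)
  have "(\<Sum>i\<le>n. f (Polynomial.coeff p i) * x ^ i) = 0"
    using p(2) by (simp add: poly_altdef deg coeff_map_poly)
  moreover have "{..n} = insert n {..<n}" by auto
  ultimately have eq: "x ^ n + (\<Sum>i<n. f (Polynomial.coeff p i) * x ^ i) = 0"
    using p(1) by (simp add: n_def)
  have "n > 0"
    using eq by (cases n) auto
  moreover have "- (\<Sum>i<n. f (Polynomial.coeff p i) * x ^ i) \<in> M.span ((\<lambda>i. x ^ i) ` {..<n})"
    by (intro M.span_neg M.span_sum M.span_scale M.span_base) auto
  then have "x ^ n \<in> M.span ((\<lambda>i. x ^ i) ` {..<n})"
    using eq by (simp add: eq_neg_iff_add_eq_0[symmetric])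
  ultimately show ?thesis by (rule that)
qed

lemma integral_over_stable_set:
  fixes f :: "'a::comm_ring_1 \<Rightarrow> 'b::field"
  assumes f: "comm_ring_hom f" and x: "integral_over f x" and y: "integral_over f y"
  obtains V where "finite V" "1 \<in> V"
    "\<And>v. v \<in> V \<Longrightarrow> x * v \<in> module.span (\<lambda>r x. f r * x) V"
    "\<And>v. v \<in> V \<Longrightarrow> y * v \<in> module.span (\<lambda>r x. f r * x) V"
proof -
  interpret comm_ring_hom f by fact
  interpret M: Modules.module "\<lambda>r x. f r * x" by (rule module_hom_scale[OF f])
  obtain n where n: "n > 0" "x ^ n \<in> M.span ((\<lambda>i. x ^ i) ` {..<n})"
    using integral_over_power_span[OF f x] by blast
  obtain m where m: "m > 0" "y ^ m \<in> M.span ((\<lambda>i. y ^ i) ` {..<m})"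
    using integral_over_power_span[OF f y] by blast
  define V where "V = (\<lambda>(i, j). x ^ i * y ^ j) ` ({..<n} \<times> {..<m})"
  have inV: "x ^ i * y ^ j \<in> V" if "i < n" "j < m" for i j
    using that by (force simp: V_def)
  have mult: "s * t \<in> M.span W" if s: "s \<in> M.span U" and U: "\<And>u. u \<in> U \<Longrightarrow> u * t \<in> M.span W" for s t U W
    using s
  proof (induction rule: M.span_induct_alt)
    case base
    show ?case by (simp add: M.span_zero)
  next
    case (step c u s)
    have "f c * (u * t) + s * t \<in> M.span W"
      using step U by (intro M.span_add M.span_scale) auto
    then show ?case by (simp add: algebra_simps)
  qed
  have "finite V" by (simp add: V_def)
  moreover have "1 \<in> V" using inV[of 0 0] n m by simp
  moreover have "x * v \<in> M.span V" if "v \<in> V" for v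
  proof -
    obtain i j where ij: "i < n" "j < m" "v = x ^ i * y ^ j" using \<open>v \<in> V\<close> by (auto simp: V_def)
    show ?thesis
    proof (cases "Suc i < n")
      case True
      then show ?thesis using inV[of "Suc i" j] ij M.span_base[of _ V] by (simp add: mult.assoc)
    next
      case False
      then have "n = Suc i" using ij by simp
      have "x ^ n * y ^ j \<in> M.span V"
        by (rule mult[OF n(2)]) (use inV ij in \<open>auto intro: M.span_base\<close>)
      then show ?thesis using ij \<open>n = Suc i\<close> by (simp add: mult.assoc)
    qed
  qed
  moreover have "y * v \<in> M.span V" if "v \<in> V" for v
  proof -
    obtain i j where ij: "i < n" "j < m" "v = x ^ i * y ^ j" using \<open>v \<in> V\<close> by (auto simp: V_def)
    show ?thesis
    proof (cases "Suc j < m")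
      case True
      then show ?thesis using inV[of i "Suc j"] ij M.span_base[of _ V] by (simp add: algebra_simps)
    next
      case False
      then have "m = Suc j" using ij by simp
      have "y ^ m * x ^ i \<in> M.span V"
      proof (rule mult[OF m(2)])
        fix u assume "u \<in> (\<lambda>i. y ^ i) ` {..<m}"
        then have "x ^ i * u \<in> V" using inV ij by auto
        then show "u * x ^ i \<in> M.span V" by (simp add: M.span_base mult.commute[of u])
      qed
      then show ?thesis using ij \<open>m = Suc j\<close> by (simp add: algebra_simps)
    qed
  qed
  ultimately show ?thesis by (rule that)
qed

lemma
  fixes f :: "'a::comm_ring_1 \<Rightarrow> 'b::field"
  assumes f: "comm_ring_hom f" and x: "integral_over f x" and y: "integral_over f y"
  shows integral_over_add: "integral_over f (x + y)"
    and integral_over_diff: "integral_over f (x - y)"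
    and integral_over_mult: "integral_over f (x * y)"
proof -
  interpret comm_ring_hom f by fact
  interpret M: Modules.module "\<lambda>r x. f r * x" by (rule module_hom_scale[OF f])
  obtain V where V: "finite V" "1 \<in> V"
    "\<And>v. v \<in> V \<Longrightarrow> x * v \<in> M.span V" "\<And>v. v \<in> V \<Longrightarrow> y * v \<in> M.span V"
    using integral_over_stable_set[OF f x y] by blast
  have xspan: "x * s \<in> M.span V" if "s \<in> M.span V" for s
    using that
  proof (induction rule: M.span_induct_alt)
    case base
    show ?case by (simp add: M.span_zero)
  next
    case (step c u s)
    have "f c * (x * u) + x * s \<in> M.span V"
      using step V(3) by (intro M.span_add M.span_scale) auto
    then show ?case by (simp add: algebra_simps)
  qed
  note crit = integral_over_if_stable[OF f V(1,2) one_neq_zero]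
  show "integral_over f (x + y)"
    by (rule crit) (simp add: distrib_right M.span_add V)
  show "integral_over f (x - y)"
    by (rule crit) (simp add: left_diff_distrib M.span_diff V)
  show "integral_over f (x * y)"
    by (rule crit) (simp add: mult.assoc xspan V)
qed


section \<open>The ring \<open>R\<^sup>+\<close> of an integral domain \<open>R\<close>\<close>

text \<open>
  The embedding of \<open>R\<close> into the algebraic closure of its field of fractions \<open>Q(R) = 'a fract\<close>.
\<close>

definition to_closure :: "'a::idom \<Rightarrow> 'a fract alg_closure" where
  "to_closure r = to_ac (to_fract r)"

lemma inj_comm_ring_hom_to_closure: "inj_comm_ring_hom to_closure"
  by unfold_locales (simp_all add: to_closure_def)

lemma comm_ring_hom_to_closure: "comm_ring_hom to_closure"
  using inj_comm_ring_hom_to_closure by (rule inj_comm_ring_hom.axioms)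

typedef (overloaded) 'a plus_closure =
  "{x :: 'a::idom fract alg_closure. integral_over to_closure x}"
  morphisms of_plus Abs_plus_closure
  using integral_over_hom[OF comm_ring_hom_to_closure] by blast

setup_lifting type_definition_plus_closure

instantiation plus_closure :: (idom) idom
begin

lift_definition zero_plus_closure :: "'a plus_closure" is 0
  using integral_over_hom[OF comm_ring_hom_to_closure, of 0] by (simp add: to_closure_def)

lift_definition one_plus_closure :: "'a plus_closure" is 1
  using integral_over_hom[OF comm_ring_hom_to_closure, of 1] by (simp add: to_closure_def)

lift_definition plus_plus_closure :: "'a plus_closure \<Rightarrow> 'a plus_closure \<Rightarrow> 'a plus_closure" is "(+)"
  by (rule integral_over_add[OF comm_ring_hom_to_closure])

lift_definition minus_plus_closure :: "'a plus_closure \<Rightarrow> 'a plus_closure \<Rightarrow> 'a plus_closure" is "(-)"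
  by (rule integral_over_diff[OF comm_ring_hom_to_closure])

lift_definition uminus_plus_closure :: "'a plus_closure \<Rightarrow> 'a plus_closure" is uminus
proof -
  fix x :: "'a fract alg_closure"
  assume x: "integral_over to_closure x"
  have "integral_over to_closure (0 :: 'a fract alg_closure)"
    using integral_over_hom[OF comm_ring_hom_to_closure, of 0] by (simp add: to_closure_def)
  from integral_over_diff[OF comm_ring_hom_to_closure this x]
  show "integral_over to_closure (- x)" by simp
qed

lift_definition times_plus_closure :: "'a plus_closure \<Rightarrow> 'a plus_closure \<Rightarrow> 'a plus_closure" is "(*)"
  by (rule integral_over_mult[OF comm_ring_hom_to_closure])

instance
  by standard (transfer; simp add: algebra_simps)+

end

lift_definition to_plus :: "'a::idom \<Rightarrow> 'a plus_closure" is to_closure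
  by (rule integral_over_hom[OF comm_ring_hom_to_closure])

end

theory Submission
  imports Defs
begin

text \<open>
  \<open>R\<^sup>+\<close> is absolutely integrally closed because integrality is transitive, and it is tight over \<open>R\<close>
  because the constant coefficient of an integral equation without root \<open>0\<close> is a multiple of the
  given element. Conversely, let \<open>S\<close> be an aic of \<open>R\<close>. By tightness \<open>S\<close> is a domain. Zorn's lemma,
  applied to the subrings of \<open>S \<times> K\<close> (with \<open>K\<close> the algebraic closure of \<open>Q(R)\<close>) that are graphs of
  partial homomorphisms, extends \<open>R \<rightarrow> K\<close> to \<open>S \<rightarrow> K\<close>. The extension lands in \<open>R\<^sup>+\<close>; its kernel meets
  \<open>R\<close> in \<open>0\<close>, so it is injective by tightness; and it is onto \<open>R\<^sup>+\<close> since every monic polynomial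
  over \<open>R\<close> already splits in \<open>S\<close>.
\<close>

section \<open>Transitivity of integrality\<close>

text \<open>Multiplication by \<open>t\<close> is R-linear, so it suffices to check it on
  generators.\<close>

lemma span_mult_right:
  fixes f :: "'a::comm_ring_1 \<Rightarrow> 'b::comm_ring_1"
  assumes f: "comm_ring_hom f"
    and s: "s \<in> module.span (\<lambda>r x. f r * x) U"
    and U: "\<And>u. u \<in> U \<Longrightarrow> u * t \<in> module.span (\<lambda>r x. f r * x) W"
  shows "s * t \<in> module.span (\<lambda>r x. f r * x) W"
proof -
  interpret M: Modules.module "\<lambda>r x. f r * x" by (rule module_hom_scale[OF f])
  show ?thesis
    using s
  proof (induction rule: M.span_induct_alt)
    case base
    show ?case by (simp add: M.span_zero)
  next
    case (step c u s)
    have "f c * (u * t) + s * t \<in> M.span W"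
      using step U by (intro M.span_add M.span_scale) auto
    then show ?case by (simp add: algebra_simps)
  qed
qed

lemma monic_root_eq:
  fixes p :: "'b::comm_ring_1 poly"
  assumes "monic p" "poly p x = 0"
  shows "x ^ Polynomial.degree p + (\<Sum>i<Polynomial.degree p. Polynomial.coeff p i * x ^ i) = 0"
proof -
  have "(\<Sum>i\<le>Polynomial.degree p. Polynomial.coeff p i * x ^ i) = 0"
    using assms(2) by (simp add: poly_altdef)
  then show ?thesis
    using assms(1) by (simp add: lessThan_Suc_atMost[symmetric] add.commute)
qed

text \<open>The inductive step for building finite modules: from the module spanned by
  \<open>V\<close> pass to the one spanned by all \<open>x ^ i * v\<close> with \<open>i\<close>
  below the degree of \<open>p\<close>. Higher powers of \<open>x\<close> reduce through
  \<open>p\<close>, whose coefficients stabilise the span of \<open>V\<close>. The last conclusion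
  lets the step be iterated: what was stable on \<open>V\<close> stays stable on
  \<open>W\<close>.\<close>

lemma stable_set_extend:
  fixes f :: "'a::comm_ring_1 \<Rightarrow> 'b::field"
  assumes f: "comm_ring_hom f"
    and V: "finite V" "1 \<in> V"
    and p: "monic p" "poly p x = 0"
    and c: "\<And>i v. v \<in> V \<Longrightarrow> Polynomial.coeff p i * v \<in> module.span (\<lambda>r x. f r * x) V"
  obtains W where "finite W" "1 \<in> W"
    "\<And>w. w \<in> W \<Longrightarrow> x * w \<in> module.span (\<lambda>r x. f r * x) W"
    "\<And>a w. (\<And>v. v \<in> V \<Longrightarrow> a * v \<in> module.span (\<lambda>r x. f r * x) V) \<Longrightarrow> w \<in> W \<Longrightarrow>
       a * w \<in> module.span (\<lambda>r x. f r * x) W"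
proof -
  interpret comm_ring_hom f by fact
  interpret M: Modules.module "\<lambda>r x. f r * x" by (rule module_hom_scale[OF f])
  define n where "n = Polynomial.degree p"
  note eq = monic_root_eq[OF p, folded n_def]
  \<comment> \<open>In degree 0 the equation would read \<open>1 = 0\<close>. Positivity makes the
    exponent 0 available, which gives \<open>1 \<in> W\<close>.\<close>
  have "n > 0"
    using eq by (cases n) auto
  define W where "W = (\<lambda>(i, v). x ^ i * v) ` ({..<n} \<times> V)"
  have inW: "x ^ i * v \<in> W" if "i < n" "v \<in> V" for i v
    using that by (force simp: W_def)
  have stable: "a * w \<in> M.span W" if a: "\<And>v. v \<in> V \<Longrightarrow> a * v \<in> M.span V" and w: "w \<in> W" for a w
  proof -
    obtain i v where iv: "i < n" "v \<in> V" "w = x ^ i * v"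
      using w by (auto simp: W_def)
    have "(a * v) * x ^ i \<in> M.span W"
      by (rule span_mult_right[OF f a[OF iv(2)]], subst mult.commute, rule M.span_base, rule inW[OF iv(1)])
    then show ?thesis
      by (simp add: iv algebra_simps)
  qed
  show ?thesis
  proof (rule that)
    show "finite W" using V by (simp add: W_def)
    show "1 \<in> W" using inW[of 0 1] \<open>n > 0\<close> V by simp
    show "a * w \<in> M.span W" if "\<And>v. v \<in> V \<Longrightarrow> a * v \<in> M.span V" "w \<in> W" for a w
      using that by (rule stable)
    show "x * w \<in> M.span W" if "w \<in> W" for w
    proof -
      obtain i v where iv: "i < n" "v \<in> V" "w = x ^ i * v"
        using \<open>w \<in> W\<close> by (auto simp: W_def)
      show ?thesis
      proof (cases "Suc i < n")
        case True
        then show ?thesis using inW[of "Suc i" v] iv M.span_base[of _ W] by (simp add: mult.assoc)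
      next
        case False
        then have n: "n = Suc i" using iv by simp
        \<comment> \<open>The exponent leaves the permitted range, so \<open>p\<close> is used to
          rewrite the top power by lower ones.\<close>
        have "x ^ n * v = - (\<Sum>j<n. Polynomial.coeff p j * (x ^ j * v))"
          using arg_cong[OF eq, of "\<lambda>t. t * v"]
          by (simp add: distrib_right sum_distrib_right mult.assoc eq_neg_iff_add_eq_0)
        moreover have "(\<Sum>j<n. Polynomial.coeff p j * (x ^ j * v)) \<in> M.span W"
          by (rule M.span_sum, rule stable[OF c]) (use inW iv in auto)
        ultimately have "x ^ n * v \<in> M.span W"
          by (simp add: M.span_neg)
        then show ?thesis by (simp add: iv n mult.assoc)
      qed
    qed
  qed
qed

text \<open>The elements are adjoined one at a time, starting from \<open>{1}\<close>. The integral
  equation of each has coefficients in the image of R, and these act as scalars, so they stabilise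
  every span.\<close>

lemma integral_over_common_stable_set:
  fixes f :: "'a::comm_ring_1 \<Rightarrow> 'b::field"
  assumes f: "comm_ring_hom f" and "finite A" "\<And>a. a \<in> A \<Longrightarrow> integral_over f a"
  obtains V where "finite V" "1 \<in> V"
    "\<And>a v. a \<in> A \<Longrightarrow> v \<in> V \<Longrightarrow> a * v \<in> module.span (\<lambda>r x. f r * x) V"
proof -
  interpret comm_ring_hom f by fact
  interpret M: Modules.module "\<lambda>r x. f r * x" by (rule module_hom_scale[OF f])
  have "\<exists>V. finite V \<and> 1 \<in> V \<and> (\<forall>a\<in>A. \<forall>v\<in>V. a * v \<in> M.span V)"
    using assms(2,3)
  proof (induction A rule: finite_induct)
    case empty
    show ?case by (intro exI[of _ "{1}"]) auto
  next
    case (insert a A)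
    then obtain V where V: "finite V" "1 \<in> V" "\<And>a v. a \<in> A \<Longrightarrow> v \<in> V \<Longrightarrow> a * v \<in> M.span V"
      by auto
    obtain p where p: "monic p" "poly (map_poly f p) a = 0"
      using insert.prems[of a] unfolding integral_over_def by blast
    have "Polynomial.degree (map_poly f p) = Polynomial.degree p"
      by (rule degree_map_poly) (use p(1) in auto)
    then have monic: "monic (map_poly f p)"
      using p(1) by (simp add: coeff_map_poly)
    obtain W where "finite W" "1 \<in> W" "\<And>w. w \<in> W \<Longrightarrow> a * w \<in> M.span W"
      "\<And>b w. (\<And>v. v \<in> V \<Longrightarrow> b * v \<in> M.span V) \<Longrightarrow> w \<in> W \<Longrightarrow> b * w \<in> M.span W"
      by (rule stable_set_extend[OF f V(1,2) monic p(2)])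
        (auto simp: coeff_map_poly intro: M.span_scale M.span_base)
    then show ?case
      using V(3) by (intro exI[of _ W]) blast
  qed
  then show ?thesis using that by blast
qed

text \<open>Choose a finite set stable under all coefficients of \<open>p\<close> and adjoin
  \<open>z\<close> to it. The result is a finite set whose span is stable under \<open>z\<close>, so
  the characteristic polynomial argument applies.\<close>

lemma integral_over_trans:
  fixes f :: "'a::comm_ring_1 \<Rightarrow> 'b::field"
  assumes f: "comm_ring_hom f"
    and p: "monic p" "poly p z = 0" "\<And>i. integral_over f (Polynomial.coeff p i)"
  shows "integral_over f z"
proof -
  interpret comm_ring_hom f by fact
  interpret M: Modules.module "\<lambda>r x. f r * x" by (rule module_hom_scale[OF f])
  have "finite (range (Polynomial.coeff p))"
  proof (rule finite_subset)
    show "range (Polynomial.coeff p) \<subseteq> insert 0 (Polynomial.coeff p ` {..Polynomial.degree p})"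
    proof
      fix c assume "c \<in> range (Polynomial.coeff p)"
      then obtain i where "c = Polynomial.coeff p i" by blast
      then show "c \<in> insert 0 (Polynomial.coeff p ` {..Polynomial.degree p})"
        by (cases "i \<le> Polynomial.degree p") (auto simp: coeff_eq_0)
    qed
  qed simp
  then obtain V where V: "finite V" "1 \<in> V"
    "\<And>a v. a \<in> range (Polynomial.coeff p) \<Longrightarrow> v \<in> V \<Longrightarrow> a * v \<in> M.span V"
    by (rule integral_over_common_stable_set[OF f]) (use p(3) in auto)
  obtain W where W: "finite W" "1 \<in> W" "\<And>w. w \<in> W \<Longrightarrow> z * w \<in> M.span W"
    by (rule stable_set_extend[OF f V(1,2) p(1,2)]) (use V(3) in auto)
  show ?thesis
    by (rule integral_over_if_stable[OF f W(1,2) one_neq_zero W(3)])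
qed


section \<open>Tight and integral extensions\<close>

text \<open>Every non-zero ideal contains a non-zero principal ideal, so tightness need only be
  tested on the ideals \<open>x * S\<close>.\<close>

lemma tight_extension_iff:
  fixes f :: "'a::comm_ring_1 \<Rightarrow> 'b::comm_ring_1"
  assumes f: "comm_ring_hom f"
  shows "tight_extension f \<longleftrightarrow> (\<forall>x. x \<noteq> 0 \<longrightarrow> (\<exists>s. x * s \<in> range f \<and> x * s \<noteq> 0))"
proof -
  interpret comm_ring_hom f by fact
  let ?S = "ring_of_type_algebra :: 'b ring"
  have S: "ring ?S" by (rule ring_from_type_algebra)
  have simps: "carrier ?S = UNIV" "\<And>x y. x \<otimes>\<^bsub>?S\<^esub> y = x * y" "\<And>x y. x \<oplus>\<^bsub>?S\<^esub> y = x + y" "\<zero>\<^bsub>?S\<^esub> = 0"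
    by (simp_all add: ring_of_type_algebra_def)
  show ?thesis
  proof (intro iffI allI impI)
    fix x :: 'b assume tight: "tight_extension f" and x: "x \<noteq> 0"
    define I where "I = range (\<lambda>s. x * s)"
    have "x * s + x * t \<in> I" "- (x * s) \<in> I" "t * (x * s) \<in> I" for s t
      unfolding I_def
      by (auto simp: image_iff intro: exI[of _ "s + t"] exI[of _ "- s"] exI[of _ "t * s"] simp: algebra_simps)
    then have I: "a + b \<in> I" "- a \<in> I" "t * a \<in> I" if "a \<in> I" "b \<in> I" for a b t
      using that by (auto simp: I_def)
    have "0 \<in> I"
      by (auto simp: I_def image_iff intro: exI[of _ 0])
    \<comment> \<open>The ideal axioms refer to the inverse of the additive group structure, which
      has to be identified with the class operation.\<close>
    have inv: "inv\<^bsub>add_monoid ?S\<^esub> a = - a" for a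
    proof -
      interpret S: ring ?S by fact
      have "a \<oplus>\<^bsub>?S\<^esub> (\<ominus>\<^bsub>?S\<^esub> a) = \<zero>\<^bsub>?S\<^esub>"
        by (rule S.r_neg) (simp add: simps)
      then show ?thesis
        by (simp add: simps a_inv_def eq_neg_iff_add_eq_0 add.commute)
    qed
    have "ideal I ?S"
    proof (rule idealI[OF S])
      interpret S: ring ?S by fact
      show "subgroup I (add_monoid ?S)"
        by (rule group.subgroupI[OF S.add.is_group]; (unfold inv)?)
          (use I \<open>0 \<in> I\<close> in \<open>auto simp: simps\<close>)
    qed (use I in \<open>auto simp: simps mult.commute\<close>)
    moreover have "x \<in> I"
      by (auto simp: I_def image_iff intro: exI[of _ 1])
    ultimately have "I \<inter> range f \<noteq> {0}"
      using tight x unfolding tight_extension_def by blast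
    moreover have "0 \<in> range f"
      by (metis hom_zero rangeI)
    ultimately obtain y where "y \<in> I" "y \<in> range f" "y \<noteq> 0"
      using \<open>0 \<in> I\<close> by blast
    then show "\<exists>s. x * s \<in> range f \<and> x * s \<noteq> 0"
      by (auto simp: I_def)
  next
    assume *: "\<forall>x. x \<noteq> 0 \<longrightarrow> (\<exists>s. x * s \<in> range f \<and> x * s \<noteq> 0)"
    show "tight_extension f"
      unfolding tight_extension_def
    proof (intro allI impI)
      fix I :: "'b set" assume "ideal I ?S" "I \<noteq> {0}"
      interpret I: ideal I ?S by fact
      have "0 \<in> I"
        using additive_subgroup.zero_closed[OF I.is_additive_subgroup] by (simp add: simps)
      then obtain x where x: "x \<in> I" "x \<noteq> 0"
        using \<open>I \<noteq> {0}\<close> by blast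
      obtain s where s: "x * s \<in> range f" "x * s \<noteq> 0"
        using * x(2) by blast
      have "x * s \<in> I"
        using I.I_r_closed[OF x(1), of s] by (simp add: simps)
      then show "I \<inter> range f \<noteq> {0}"
        using s by blast
    qed
  qed
qed

text \<open>Non-zero \<open>x\<close> and \<open>y\<close> have non-zero multiples
  \<open>f a\<close> and \<open>f b\<close>. If \<open>x * y = 0\<close>, then
  \<open>f (a * b) = 0\<close>, which is impossible in a domain R.\<close>

lemma tight_extension_no_zero_divisors:
  fixes f :: "'a::idom \<Rightarrow> 'b::comm_ring_1"
  assumes f: "inj_comm_ring_hom f" and tight: "tight_extension f"
    and xy: "(x :: 'b) * y = 0"
  shows "x = 0 \<or> y = 0"
proof (rule ccontr)
  interpret inj_comm_ring_hom f by fact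
  assume "\<not> (x = 0 \<or> y = 0)"
  then obtain s t a b where *: "x * s = f a" "f a \<noteq> 0" "y * t = f b" "f b \<noteq> 0"
    using tight unfolding tight_extension_iff[OF comm_ring_hom_axioms] by (metis imageE)
  have "f (a * b) = (x * y) * (s * t)"
    by (simp add: hom_mult flip: *)
  then have "a * b = 0"
    using xy by simp
  then show False using * by auto
qed

text \<open>As long as the constant coefficient vanishes, a factor X can be cancelled, because
  \<open>x\<close> is non-zero and not a zero divisor. The condition \<open>nzd\<close> is an
  assumption since an aic is a domain by a proof, not by its type class.\<close>

lemma poly_root_coeff_0_neq_0:
  fixes f :: "'a::comm_ring_1 \<Rightarrow> 'b::comm_ring_1"
  assumes f: "comm_ring_hom f"
    and nzd: "\<And>x y :: 'b. x * y = 0 \<Longrightarrow> x = 0 \<or> y = 0"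
    and "x \<noteq> 0" "p \<noteq> 0" "poly (map_poly f p) x = 0"
  obtains q where "Polynomial.coeff q 0 \<noteq> 0" "poly (map_poly f q) x = 0"
proof -
  interpret comm_ring_hom f by fact
  have "\<exists>q. Polynomial.coeff q 0 \<noteq> 0 \<and> poly (map_poly f q) x = 0"
    using assms(4,5)
  proof (induction p rule: pCons_induct)
    case 0
    then show ?case by simp
  next
    case (pCons c p)
    show ?case
    proof (cases "c = 0")
      case True
      with pCons.prems have "x * poly (map_poly f p) x = 0" "p \<noteq> 0"
        by (auto simp: map_poly_pCons)
      then show ?thesis
        using nzd \<open>x \<noteq> 0\<close> pCons.IH by blast
    next
      case False
      then show ?thesis
        using pCons.prems by (intro exI[of _ "pCons c p"]) simp
    qed
  qed
  then show ?thesis using that by blast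
qed

lemma tight_extension_integral:
  fixes f :: "'a::comm_ring_1 \<Rightarrow> 'b::idom"
  assumes f: "inj_comm_ring_hom f" and int: "integral_extension f"
  shows "tight_extension f"
proof -
  interpret inj_comm_ring_hom f by fact
  show ?thesis
    unfolding tight_extension_iff[OF comm_ring_hom_axioms]
  proof (intro allI impI)
    fix x :: 'b assume x: "x \<noteq> 0"
    obtain p where p: "monic p" "poly (map_poly f p) x = 0"
      using int unfolding integral_extension_def integral_over_def by blast
    have "p \<noteq> 0"
      using p by auto
    have "a = 0 \<or> b = 0" if "a * b = 0" for a b :: 'b
      using that by simp
    from poly_root_coeff_0_neq_0[OF comm_ring_hom_axioms this x \<open>p \<noteq> 0\<close> p(2)]
    obtain q where q: "Polynomial.coeff q 0 \<noteq> 0" "poly (map_poly f q) x = 0"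
      by blast
    obtain c q' where q': "q = pCons c q'" by (cases q)
    have "f c + x * poly (map_poly f q') x = 0"
      using q q' by simp
    \<comment> \<open>Splitting off the constant coefficient of \<open>q\<close> exhibits
      \<open>f c\<close> as a multiple of \<open>x\<close>.\<close>
    then have eq: "x * (- poly (map_poly f q') x) = f c"
      by (simp add: add_eq_0_iff2)
    have "f c \<noteq> 0"
      using q(1) q' by simp
    then show "\<exists>s. x * s \<in> range f \<and> x * s \<noteq> 0"
      using eq by (intro exI[of _ "- poly (map_poly f q') x"]) (auto simp del: mult_minus_right)
  qed
qed


section \<open>Extending homomorphisms along integral extensions\<close>

text \<open>A subring of the product ring. Graphs of partial homomorphisms are the single-valued
  ones, and by additivity single-valuedness amounts to \<open>(0, y) \<in> G\<close> forcing
  \<open>y = 0\<close>.\<close>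

definition subring_rel :: "('b::comm_ring_1 \<times> 'k::comm_ring_1) set \<Rightarrow> bool" where
  "subring_rel G \<longleftrightarrow> (1, 1) \<in> G \<and>
     (\<forall>x y x' y'. (x, y) \<in> G \<longrightarrow> (x', y') \<in> G \<longrightarrow> (x - x', y - y') \<in> G \<and> (x * x', y * y') \<in> G)"

text \<open>If \<open>G\<close> is the graph of a partial homomorphism, this is the graph of its
  coefficientwise action on polynomials.\<close>

definition poly_rel :: "('b::comm_ring_1 \<times> 'k::comm_ring_1) set \<Rightarrow> ('b poly \<times> 'k poly) set" where
  "poly_rel G = {(a, b). \<forall>i. (Polynomial.coeff a i, Polynomial.coeff b i) \<in> G}"

lemma
  assumes "subring_rel G"
  shows subring_rel_1: "(1, 1) \<in> G"
    and subring_rel_diff: "(x, y) \<in> G \<Longrightarrow> (x', y') \<in> G \<Longrightarrow> (x - x', y - y') \<in> G"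
    and subring_rel_mult: "(x, y) \<in> G \<Longrightarrow> (x', y') \<in> G \<Longrightarrow> (x * x', y * y') \<in> G"
  using assms unfolding subring_rel_def by blast+

lemma subring_rel_0: "subring_rel G \<Longrightarrow> (0, 0) \<in> G"
  using subring_rel_diff[of G 1 1 1 1] subring_rel_1[of G] by simp

lemma subring_rel_add:
  assumes "subring_rel G" "(x, y) \<in> G" "(x', y') \<in> G"
  shows "(x + x', y + y') \<in> G"
proof -
  have "(x - (0 - x'), y - (0 - y')) \<in> G"
    by (intro subring_rel_diff subring_rel_0 assms)
  then show ?thesis by simp
qed

lemma subring_rel_sum:
  assumes "subring_rel G" "\<And>i. i \<in> A \<Longrightarrow> (u i, v i) \<in> G"
  shows "(\<Sum>i\<in>A. u i, \<Sum>i\<in>A. v i) \<in> G"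
  using assms(2)
  by (induction A rule: infinite_finite_induct) (auto intro: subring_rel_0 subring_rel_add assms(1))

lemma subring_rel_poly_rel:
  assumes G: "subring_rel G"
  shows "subring_rel (poly_rel G)"
  unfolding subring_rel_def
  by (auto simp: poly_rel_def coeff_mult coeff_1 intro!: subring_rel_sum[OF G]
      intro: subring_rel_1[OF G] subring_rel_0[OF G] subring_rel_diff[OF G] subring_rel_mult[OF G])

lemma poly_rel_monom:
  "subring_rel G \<Longrightarrow> (x, y) \<in> G \<Longrightarrow> (Polynomial.monom x n, Polynomial.monom y n) \<in> poly_rel G"
  by (auto simp: poly_rel_def coeff_monom intro: subring_rel_0)

lemma poly_rel_map_poly:
  assumes "subring_rel G" "comm_ring_hom f" "comm_ring_hom g" "\<And>r. (f r, g r) \<in> G"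
  shows "(map_poly f p, map_poly g p) \<in> poly_rel G"
proof -
  interpret f: comm_ring_hom f by fact
  interpret g: comm_ring_hom g by fact
  show ?thesis
    using assms(4) by (simp add: poly_rel_def coeff_map_poly)
qed

lemma poly_rel_poly:
  assumes G: "subring_rel G" and "(a, b) \<in> poly_rel G" "(x, y) \<in> G"
  shows "(poly a x, poly b y) \<in> G"
proof -
  have pow: "(x ^ i, y ^ i) \<in> G" for i
    by (induction i) (auto intro: subring_rel_1 subring_rel_mult G assms(3))
  \<comment> \<open>For a general \<open>G\<close> the two degrees may differ, so both sums are
    padded with zeros to a common length.\<close>
  define n where "n = max (Polynomial.degree a) (Polynomial.degree b)"
  have "poly a x = (\<Sum>i\<le>n. Polynomial.coeff a i * x ^ i)" "poly b y = (\<Sum>i\<le>n. Polynomial.coeff b i * y ^ i)"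
    unfolding poly_altdef
    by (rule sum.mono_neutral_left; auto simp: n_def coeff_eq_0)+
  then show ?thesis
    using assms(2) by (auto simp: poly_rel_def intro!: subring_rel_sum[OF G] subring_rel_mult[OF G] pow)
qed

text \<open>As for simple field extensions, \<open>x\<close> is sent to a root \<open>y\<close> of
  the image \<open>q\<close> of a polynomial \<open>p\<close> of least degree vanishing at
  \<open>x\<close>. The domain of \<open>G\<close> is only a ring and \<open>p\<close> need not be
  monic, so pseudo-division by \<open>p\<close> replaces division. Injectivity of \<open>G\<close>
  makes related polynomials have equal degrees.\<close>

lemma partial_hom_extend:
  fixes G :: "('b::comm_ring_1 \<times> 'k::alg_closed_field) set"
  assumes G: "subring_rel G"
    and left: "\<And>y. (0, y) \<in> G \<Longrightarrow> y = 0" and right: "\<And>x. (x, 0) \<in> G \<Longrightarrow> x = 0"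
    and root: "\<exists>(p, q) \<in> poly_rel G. p \<noteq> 0 \<and> poly p x = 0"
  obtains y G' where "subring_rel G'" "G \<subseteq> G'" "(x, y) \<in> G'" "\<And>z. (0, z) \<in> G' \<Longrightarrow> z = 0"
proof -
  note P = subring_rel_poly_rel[OF G]
  have coeff: "Polynomial.coeff a i = 0 \<longleftrightarrow> Polynomial.coeff b i = 0" if "(a, b) \<in> poly_rel G" for a b i
    using that left right unfolding poly_rel_def by (metis (mono_tags, lifting) case_prodD mem_Collect_eq)
  have degree: "Polynomial.degree a = Polynomial.degree b" if "(a, b) \<in> poly_rel G" for a b
    using coeff[OF that] by (simp add: Polynomial.degree_def)
  define n where "n = (LEAST n. \<exists>(p, q) \<in> poly_rel G. p \<noteq> 0 \<and> poly p x = 0 \<and> Polynomial.degree p = n)"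
  have "\<exists>(p, q) \<in> poly_rel G. p \<noteq> 0 \<and> poly p x = 0 \<and> Polynomial.degree p = n"
    unfolding n_def by (rule LeastI_ex) (use root in blast)
  then obtain p q where pq: "(p, q) \<in> poly_rel G" "p \<noteq> 0" "poly p x = 0" "Polynomial.degree p = n"
    by blast
  have least: "n \<le> Polynomial.degree a" if "(a, b) \<in> poly_rel G" "a \<noteq> 0" "poly a x = 0" for a b
    unfolding n_def by (rule Least_le) (use that in blast)
  \<comment> \<open>A non-zero constant has no root. So \<open>q\<close>, having the same degree as
    \<open>p\<close>, is non-constant and has a root in the algebraically closed field.\<close>
  have "n > 0"
    using pq by (metis degree_eq_zeroE gr0I pCons_eq_0_iff poly_const_conv)
  then obtain y where y: "poly q y = 0"
    using alg_closed_imp_poly_has_root[of q] degree[OF pq(1)] pq(4) by auto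
  define G' where "G' = (\<lambda>(a, b). (poly a x, poly b y)) ` poly_rel G"
  have inG': "(poly a x, poly b y) \<in> G'" if "(a, b) \<in> poly_rel G" for a b
    using that by (force simp: G'_def)
  \<comment> \<open>This is the well-definedness of the assignment of \<open>poly b y\<close> to
    \<open>poly a x\<close>, by induction on the degree.\<close>
  have zero: "poly b y = 0" if "(a, b) \<in> poly_rel G" "poly a x = 0" for a b
    using that
  proof (induction "Polynomial.degree a" arbitrary: a b rule: less_induct)
    case less
    show ?case
    proof (cases "a = 0")
      case True
      then have "b = 0"
        using coeff[OF less.prems(1)] by (simp add: poly_eq_iff)
      then show ?thesis by simp
    next
      case False
      define d where "d = Polynomial.degree a"
      have d: "Polynomial.degree b = d" and nd: "n \<le> d"
        using degree least less.prems False by (auto simp: d_def)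
      \<comment> \<open>One step of pseudo-division, carried out in parallel on both components: the
        terms of degree \<open>d\<close> cancel.\<close>
      define a' where "a' = Polynomial.monom (Polynomial.coeff p n) 0 * a -
        Polynomial.monom (Polynomial.coeff a d) (d - n) * p"
      define b' where "b' = Polynomial.monom (Polynomial.coeff q n) 0 * b -
        Polynomial.monom (Polynomial.coeff b d) (d - n) * q"
      have "(Polynomial.coeff p n, Polynomial.coeff q n) \<in> G" "(Polynomial.coeff a d, Polynomial.coeff b d) \<in> G"
        using pq(1) less.prems(1) by (auto simp: poly_rel_def)
      then have a'b': "(a', b') \<in> poly_rel G"
        unfolding a'_def b'_def
        by (intro subring_rel_diff[OF P] subring_rel_mult[OF P] poly_rel_monom[OF G] pq less.prems)
      have a'0: "poly a' x = 0"
        using less.prems pq by (simp add: a'_def)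
      have "Polynomial.degree a' < d"
      proof -
        have "Polynomial.coeff a' i = 0" if "i \<ge> d" for i
        proof (cases "i = d")
          case True
          then show ?thesis
            using nd by (simp add: a'_def coeff_monom_mult mult.commute[of "Polynomial.coeff p n"])
        next
          case False
          then show ?thesis
            using that nd pq(4) by (simp add: a'_def coeff_monom_mult coeff_eq_0 d_def)
        qed
        \<comment> \<open>The zero polynomial has degree 0, so this covers the case
          \<open>a' = 0\<close>.\<close>
        moreover have "d > 0" using \<open>n > 0\<close> nd by simp
        ultimately show ?thesis
          by (metis degree_0 leading_coeff_0_iff not_le)
      qed
      then have "poly b' y = 0"
        using less.hyps a'b' a'0 d_def by blast
      then have "Polynomial.coeff q n * poly b y = 0"
        using y by (simp add: b'_def poly_monom)
      moreover have "Polynomial.coeff q n \<noteq> 0"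
        using coeff[OF pq(1)] pq(2,4) by (metis leading_coeff_0_iff)
      ultimately show ?thesis by simp
    qed
  qed
  show ?thesis
  proof (rule that)
    show "subring_rel G'"
      unfolding subring_rel_def
    proof (intro conjI allI impI)
      show "(1, 1) \<in> G'"
        using inG'[OF subring_rel_1[OF P]] by simp
      fix s t s' t' assume "(s, t) \<in> G'" "(s', t') \<in> G'"
      then obtain a b a' b' where "(a, b) \<in> poly_rel G" "s = poly a x" "t = poly b y"
        "(a', b') \<in> poly_rel G" "s' = poly a' x" "t' = poly b' y"
        by (auto simp: G'_def)
      then show "(s - s', t - t') \<in> G'" "(s * s', t * t') \<in> G'"
        using inG'[OF subring_rel_diff[OF P, of a b a' b']] inG'[OF subring_rel_mult[OF P, of a b a' b']]
        by auto
    qed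
    show "G \<subseteq> G'"
    proof
      fix c assume "c \<in> G"
      then show "c \<in> G'"
        using inG'[OF poly_rel_monom[OF G, of "fst c" "snd c" 0]] by (simp add: poly_monom)
    qed
    \<comment> \<open>The polynomial X evaluates to \<open>x\<close> and \<open>y\<close>; constants
      gave \<open>G \<subseteq> G'\<close>.\<close>
    show "(x, y) \<in> G'"
      using inG'[OF poly_rel_monom[OF G subring_rel_1[OF G], of 1]] by (simp add: poly_monom)
    show "z = 0" if "(0, z) \<in> G'" for z
      using that zero by (auto simp: G'_def)
  qed
qed

lemma integral_extension_hom_extends:
  fixes f :: "'a::comm_ring_1 \<Rightarrow> 'b::comm_ring_1" and g :: "'a \<Rightarrow> 'k::alg_closed_field"
  assumes f: "inj_comm_ring_hom f" and g: "inj_comm_ring_hom g"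
    and int: "integral_extension f"
    and nzd: "\<And>x y :: 'b. x * y = 0 \<Longrightarrow> x = 0 \<or> y = 0"
  obtains h where "comm_ring_hom h" "\<And>r. h (f r) = g r"
proof -
  interpret f: inj_comm_ring_hom f by fact
  interpret g: inj_comm_ring_hom g by fact
  \<comment> \<open>The single-valued subrings extending the partial map that sends
    \<open>f r\<close> to \<open>g r\<close>. Injectivity of a maximal one is derived below from
    integrality.\<close>
  define \<F> where "\<F> = {G. subring_rel G \<and> range (\<lambda>r. (f r, g r)) \<subseteq> G \<and> (\<forall>y. (0, y) \<in> G \<longrightarrow> y = 0)}"
  have "\<exists>M\<in>\<F>. \<forall>H\<in>\<F>. M \<subseteq> H \<longrightarrow> H = M"
  proof (rule subset_Zorn_nonempty)
    have "subring_rel (range (\<lambda>r. (f r, g r)))"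
      unfolding subring_rel_def
    proof (intro conjI allI impI)
      show "(1, 1) \<in> range (\<lambda>r. (f r, g r))"
        by (rule range_eqI[of _ _ 1]) simp
      fix x y x' y' assume "(x, y) \<in> range (\<lambda>r. (f r, g r))" "(x', y') \<in> range (\<lambda>r. (f r, g r))"
      then obtain r r' where *: "x = f r" "y = g r" "x' = f r'" "y' = g r'"
        by auto
      show "(x - x', y - y') \<in> range (\<lambda>r. (f r, g r))"
        by (rule range_eqI[of _ _ "r - r'"]) (simp add: * f.hom_minus g.hom_minus)
      show "(x * x', y * y') \<in> range (\<lambda>r. (f r, g r))"
        by (rule range_eqI[of _ _ "r * r'"]) (simp add: * f.hom_mult g.hom_mult)
    qed
    then have "range (\<lambda>r. (f r, g r)) \<in> \<F>"
      by (auto simp: \<F>_def dest: sym)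
    then show "\<F> \<noteq> {}" by blast
  next
    fix \<C> assume \<C>: "\<C> \<noteq> {}" "subset.chain \<F> \<C>"
    have mem: "subring_rel G" "range (\<lambda>r. (f r, g r)) \<subseteq> G" "\<And>y. (0, y) \<in> G \<Longrightarrow> y = 0" if "G \<in> \<C>" for G
      using \<C>(2) that by (auto simp: \<F>_def subset_chain_def)
    have "subring_rel (\<Union>\<C>)"
      unfolding subring_rel_def
    proof (intro conjI allI impI)
      show "(1, 1) \<in> \<Union>\<C>"
        using \<C>(1) mem(1) subring_rel_1 by blast
      fix x y x' y' assume "(x, y) \<in> \<Union>\<C>" "(x', y') \<in> \<Union>\<C>"
      then obtain G where "G \<in> \<C>" "(x, y) \<in> G" "(x', y') \<in> G"
        using \<C>(2) unfolding subset_chain_def by blast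
      then show "(x - x', y - y') \<in> \<Union>\<C>" "(x * x', y * y') \<in> \<Union>\<C>"
        using subring_rel_diff subring_rel_mult mem(1) by blast+
    qed
    then show "\<Union>\<C> \<in> \<F>"
      using \<C>(1) mem(2,3) unfolding \<F>_def by blast
  qed
  then obtain G where "G \<in> \<F>" and max: "\<And>H. H \<in> \<F> \<Longrightarrow> G \<subseteq> H \<Longrightarrow> H = G"
    by blast
  then have G: "subring_rel G" and fg: "\<And>r. (f r, g r) \<in> G" and left: "\<And>y. (0, y) \<in> G \<Longrightarrow> y = 0"
    by (auto simp: \<F>_def)
  have map_poly: "(map_poly f p, map_poly g p) \<in> poly_rel G" for p
    using f.comm_ring_hom_axioms g.comm_ring_hom_axioms fg by (rule poly_rel_map_poly[OF G])
  have integral: "\<exists>p. p \<noteq> 0 \<and> poly (map_poly f p) x = 0" for x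
    using int unfolding integral_extension_def integral_over_def
    by (metis coeff_0 degree_0 zero_neq_one)
  \<comment> \<open>Evaluating an equation of \<open>x\<close> with non-zero constant coefficient at
    the pair \<open>(x, 0)\<close> puts \<open>(0, g (coeff q 0))\<close> into \<open>G\<close>, so
    \<open>g\<close> would kill that coefficient.\<close>
  have right: "x = 0" if "(x, 0) \<in> G" for x
  proof (rule ccontr)
    assume "x \<noteq> 0"
    with integral[of x] obtain q where q: "Polynomial.coeff q 0 \<noteq> 0" "poly (map_poly f q) x = 0"
      using poly_root_coeff_0_neq_0[OF f.comm_ring_hom_axioms nzd] by metis
    have "(poly (map_poly f q) x, poly (map_poly g q) 0) \<in> G"
      by (rule poly_rel_poly[OF G map_poly that])
    then have "g (Polynomial.coeff q 0) = 0"
      using left[of "g (Polynomial.coeff q 0)"] q(2) by (simp add: poly_0_coeff_0 coeff_map_poly)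
    then show False using q(1) by simp
  qed
  \<comment> \<open>The integral equation of \<open>x\<close> permits adjoining \<open>x\<close> to
    the domain; by maximality it was already there.\<close>
  have total: "\<exists>y. (x, y) \<in> G" for x
  proof -
    obtain p where "p \<noteq> 0" "poly (map_poly f p) x = 0"
      using integral by blast
    then have "\<exists>(p, q) \<in> poly_rel G. p \<noteq> 0 \<and> poly p x = 0"
      by (intro bexI[OF _ map_poly[of p]]) auto
    with G left right obtain y G'
      where "subring_rel G'" "G \<subseteq> G'" "(x, y) \<in> G'" "\<And>z. (0, z) \<in> G' \<Longrightarrow> z = 0"
      by (rule partial_hom_extend) blast+
    moreover from this have "G' \<in> \<F>"
      using fg by (auto simp: \<F>_def)
    ultimately show ?thesis using max by blast
  qed
  have unique: "y = z" if "(x, y) \<in> G" "(x, z) \<in> G" for x y z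
    using left[of "y - z"] subring_rel_diff[OF G that] by simp
  define h where "h x = (THE y. (x, y) \<in> G)" for x
  have h: "(x, h x) \<in> G" for x
    unfolding h_def using total unique by (metis theI)
  show ?thesis
  proof (rule that)
    show "h (f r) = g r" for r
      using h fg by (rule unique)
    have "h 0 = 0"
      by (rule unique[OF h subring_rel_0[OF G]])
    moreover have "h 1 = 1"
      by (rule unique[OF h subring_rel_1[OF G]])
    moreover have "h (x + y) = h x + h y" for x y
      by (rule unique[OF h subring_rel_add[OF G h h]])
    moreover have "h (x * y) = h x * h y" for x y
      by (rule unique[OF h subring_rel_mult[OF G h h]])
    ultimately show "comm_ring_hom h"
      by unfold_locales auto
  qed
qed


section \<open>The ring \<open>R\<^sup>+\<close>\<close>

lemma inj_comm_ring_hom_of_plus: "inj_comm_ring_hom of_plus"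
  by unfold_locales (transfer; simp)+

lemma of_plus_to_plus: "of_plus (to_plus r) = to_closure r"
  by (rule to_plus.rep_eq)

lemma inj_comm_ring_hom_to_plus: "inj_comm_ring_hom (to_plus :: 'a::idom \<Rightarrow> 'a plus_closure)"
proof -
  interpret c: inj_comm_ring_hom "to_closure :: 'a \<Rightarrow> _" by (rule inj_comm_ring_hom_to_closure)
  show ?thesis
    by unfold_locales (transfer; simp add: hom_distribs)+
qed

lemma of_plus_poly:
  "of_plus (poly (map_poly to_plus p) x) = poly (map_poly to_closure p) (of_plus x)"
proof -
  interpret inj_comm_ring_hom "of_plus :: 'a plus_closure \<Rightarrow> _" by (rule inj_comm_ring_hom_of_plus)
  interpret t: inj_comm_ring_hom "to_plus :: 'a \<Rightarrow> _" by (rule inj_comm_ring_hom_to_plus)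
  show ?thesis
    by (induction p) (simp_all add: map_poly_pCons hom_distribs of_plus_to_plus to_closure_def)
qed

lemma integral_extension_to_plus: "integral_extension (to_plus :: 'a::idom \<Rightarrow> 'a plus_closure)"
  unfolding integral_extension_def
proof
  fix x :: "'a plus_closure"
  interpret inj_comm_ring_hom "of_plus :: 'a plus_closure \<Rightarrow> _" by (rule inj_comm_ring_hom_of_plus)
  show "integral_over to_plus x"
    using of_plus[of x] by (simp add: integral_over_def flip: of_plus_poly)
qed

text \<open>A monic polynomial over R^+ splits in the algebraic closure. Its roots are integral over
  R by transitivity, so they lie in R^+, and the factorization is pulled back along the injective
  map on polynomials.\<close>

lemma ai_closed_plus_closure: "ai_closed TYPE('a::idom plus_closure)"
  unfolding ai_closed_def
proof (intro allI impI)
  fix p :: "'a plus_closure poly" assume "monic p"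
  interpret inj_comm_ring_hom "of_plus :: 'a plus_closure \<Rightarrow> _" by (rule inj_comm_ring_hom_of_plus)
  interpret mp: map_poly_inj_comm_ring_hom "of_plus :: 'a plus_closure \<Rightarrow> _" ..
  define q where "q = map_poly of_plus p"
  have "monic q"
    using \<open>monic p\<close> by (simp add: q_def)
  then have "q \<noteq> 0" by auto
  obtain A where "q = smult (lead_coeff q) (\<Prod>a\<in>#A. [:- a, 1:])"
    using alg_closed_imp_factorization[OF \<open>q \<noteq> 0\<close>] by blast
  moreover obtain as where "mset as = A"
    using ex_mset by blast
  ultimately have q: "q = (\<Prod>a\<leftarrow>as. [:- a, 1:])"
    using \<open>monic q\<close> by (auto simp: prod_mset_prod_list simp flip: mset_map)
  have "integral_over to_closure a" if "a \<in> set as" for a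
  proof (rule integral_over_trans[OF comm_ring_hom_to_closure \<open>monic q\<close>])
    show "poly q a = 0"
      using that by (auto simp: q poly_prod_list prod_list_zero_iff)
    show "integral_over to_closure (Polynomial.coeff q i)" for i
      using of_plus by (simp add: q_def)
  qed
  then have "map of_plus (map Abs_plus_closure as) = as"
    by (simp add: map_idI Abs_plus_closure_inverse)
  then obtain bs where bs: "as = map of_plus bs" by metis
  have "map_poly of_plus (\<Prod>b\<leftarrow>bs. [:- b, 1:]) = (\<Prod>b\<leftarrow>bs. [:- of_plus b, 1:])"
    by (simp add: mp.hom_prod_list o_def hom_distribs)
  also have "\<dots> = map_poly of_plus p"
    by (simp add: bs o_def flip: q_def) (simp add: q bs o_def)
  finally show "\<exists>as. p = (\<Prod>a\<leftarrow>as. [:- a, 1:])"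
    by (metis mp.injectivity)
qed

lemma is_aic_to_plus: "is_aic (to_plus :: 'a::idom \<Rightarrow> 'a plus_closure)"
  unfolding is_aic_def
  using inj_comm_ring_hom_to_plus ai_closed_plus_closure integral_extension_to_plus
    tight_extension_integral by blast

section \<open>Uniqueness: every aic of R is isomorphic to R^+\<close>

lemma is_aic_algebra_isom_to_plus:
  fixes f :: "'a::idom \<Rightarrow> 'b::comm_ring_1"
  assumes "is_aic f"
  obtains \<phi> where "algebra_isom f to_plus \<phi>"
proof -
  have f: "inj_comm_ring_hom f" and ai: "ai_closed TYPE('b)"
    and int: "integral_extension f" and tight: "tight_extension f"
    using assms unfolding is_aic_def by auto
  interpret f: inj_comm_ring_hom f by fact
  interpret c: inj_comm_ring_hom "to_closure :: 'a \<Rightarrow> _" by (rule inj_comm_ring_hom_to_closure)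
  interpret o: inj_comm_ring_hom "of_plus :: 'a plus_closure \<Rightarrow> _" by (rule inj_comm_ring_hom_of_plus)
  obtain h where "comm_ring_hom h" and hf: "\<And>r. h (f r) = to_closure r"
    using integral_extension_hom_extends[OF f inj_comm_ring_hom_to_closure int]
      tight_extension_no_zero_divisors[OF f tight] by blast
  interpret h: comm_ring_hom h by fact
  have h_poly: "h (poly (map_poly f p) x) = poly (map_poly to_closure p) (h x)" for p x
    by (induction p) (simp_all add: map_poly_pCons h.hom_add h.hom_mult hf)
  \<comment> \<open>Since \<open>h\<close> extends \<open>to_closure\<close>, it carries an integral
    equation of \<open>x\<close> over R to one of \<open>h x\<close>, so \<open>h\<close> factors
    through R^+.\<close>
  have "integral_over to_closure (h x)" for x
    using int unfolding integral_extension_def integral_over_def by (metis h_poly h.hom_zero)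
  then have "\<exists>\<phi>. \<forall>x. of_plus (\<phi> x) = h x"
    by (intro exI[of _ "\<lambda>x. Abs_plus_closure (h x)"]) (simp add: Abs_plus_closure_inverse)
  then obtain \<phi> where \<phi>: "\<And>x. of_plus (\<phi> x) = h x"
    by blast
  have eqI: "u = v" if "of_plus u = of_plus v" for u v :: "'a plus_closure"
    using that by (simp add: of_plus_inject)
  have inj: "x = 0" if "\<phi> x = 0" for x
  proof (rule ccontr)
    assume "x \<noteq> 0"
    then obtain s r where "x * s = f r" "x * s \<noteq> 0"
      using tight unfolding tight_extension_iff[OF f.comm_ring_hom_axioms] by blast
    moreover have "h x = 0"
      using \<phi>[of x] that by simp
    ultimately have "to_closure r = 0"
      by (metis hf h.hom_mult mult_zero_left)
    then show False
      using \<open>x * s = f r\<close> \<open>x * s \<noteq> 0\<close> by simp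
  qed
  \<comment> \<open>An equation of \<open>y\<close> over R splits in the aic, and \<open>h\<close>
    carries this splitting to the algebraic closure. There \<open>of_plus y\<close> is a root of a
    product of linear factors over a field, so it equals some \<open>h a\<close>.\<close>
  have surj: "\<exists>x. \<phi> x = y" for y
  proof -
    obtain p where p: "monic p" "poly (map_poly to_closure p) (of_plus y) = 0"
      using of_plus[of y] by (auto simp: integral_over_def)
    have "monic (map_poly f p)"
      using p(1) by simp
    then obtain as where as: "map_poly f p = (\<Prod>a\<leftarrow>as. [:- a, 1:])"
      using ai unfolding ai_closed_def by blast
    interpret hp: map_poly_comm_ring_hom h ..
    have "map_poly to_closure p = map_poly h (map_poly f p)"
      by (simp add: map_poly_map_poly o_def hf)
    also have "\<dots> = (\<Prod>a\<leftarrow>as. [:- h a, 1:])"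
      by (simp add: as hp.hom_prod_list o_def hom_distribs)
    finally have "(\<Prod>a\<leftarrow>as. of_plus y - h a) = 0"
      using p(2) by (simp add: poly_prod_list o_def)
    then obtain a where "of_plus y = h a"
      by (auto simp: prod_list_zero_iff)
    then show ?thesis
      by (intro exI[of _ a] eqI) (simp add: \<phi>)
  qed
  have "comm_ring_isom \<phi>"
  proof unfold_locales
    show "\<phi> 0 = 0" "\<phi> 1 = 1" "\<phi> (x + y) = \<phi> x + \<phi> y" "\<phi> (x * y) = \<phi> x * \<phi> y" for x y
      by (rule eqI, simp add: \<phi> o.hom_add o.hom_mult h.hom_add h.hom_mult)+
  qed (use inj surj in \<open>auto simp: surj_def eq_commute[of _ "\<phi> _"]\<close>)
  moreover have "\<phi> (f r) = to_plus r" for r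
    by (rule eqI) (simp add: \<phi> hf of_plus_to_plus)
  ultimately show ?thesis
    by (intro that[of \<phi>]) (simp add: algebra_isom_def)
qed

theorem proposition1:
  shows "is_aic (to_plus :: 'a::idom \<Rightarrow> 'a plus_closure) \<and>
         (\<forall>f :: 'a \<Rightarrow> 'b::comm_ring_1. is_aic f \<longrightarrow>
            (\<exists>\<phi> :: 'b \<Rightarrow> 'a plus_closure. algebra_isom f to_plus \<phi>))"
  using is_aic_to_plus is_aic_algebra_isom_to_plus by metis

end
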